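(* Let $\Gamma$ be an abelian group and $f:\Gamma\to\mathbb{C}$ a function with $f(0)=0$ and $\big(f(\alpha+\beta)-f(\alpha)-f(\beta)\big)\big(f(\alpha)-f(\beta)\big)=0$ for all $\alpha,\beta\in\Gamma$. Let $\Gamma_0=f^{-1}(0)$ and suppose $|f(\Gamma)|=2$. Then the $\frac12$-derivations of $V(f)$ are exactly the linear maps $\varphi:V(f)\to V(f)$ of the form $$\varphi(e_\alpha)=\begin{cases}\sum_{\gamma\in\Gamma} a_\gamma e_{\alpha+\gamma}, & \alpha\in\Gamma_0,\\ \sum_{\gamma\in\Gamma_0} a_\gamma e_{\alpha+\gamma}, & \alpha\notin\Gamma_0,\end{cases}$$ where $\{a_\gamma\}_{\gamma\in\Gamma}\subseteq\mathbb{C}$ is a family having only a finite number of non-zero elements.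
   Context: The Witt type Lie algebra $V(f)$ is the complex vector space with basis $\{e_\alpha\}_{\alpha\in\Gamma}$ and bracket $[e_\alpha,e_\beta]=(f(\beta)-f(\alpha))e_{\alpha+\beta}$. A $\frac12$-derivation of a Lie algebra $(L,[\cdot,\cdot])$ is a linear map $\varphi:L\to L$ with $\varphi([x,y])=\frac12\big([\varphi(x),y]+[x,\varphi(y)]\big)$ for all $x,y\in L$. *)

theory Defs
  imports Complex_Main "HOL-Library.Poly_Mapping"
begin

locale lie_algebra = vector_space scale
  for scale :: "'k::field \<Rightarrow> 'v::ab_group_add \<Rightarrow> 'v" +
  fixes bracket :: "'v \<Rightarrow> 'v \<Rightarrow> 'v"
  assumes linear_bracket_left: "Vector_Spaces.linear scale scale (\<lambda>x. bracket x y)"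
    and linear_bracket_right: "Vector_Spaces.linear scale scale (bracket x)"
    and bracket_self: "bracket x x = 0"
    and Jacobi: "bracket x (bracket y z) + bracket y (bracket z x) + bracket z (bracket x y) = 0"

definition half_derivation ::
    "('k::field \<Rightarrow> 'v::ab_group_add \<Rightarrow> 'v) \<Rightarrow> ('v \<Rightarrow> 'v \<Rightarrow> 'v) \<Rightarrow> ('v \<Rightarrow> 'v) \<Rightarrow> bool" where
  "half_derivation scale bracket \<phi> \<longleftrightarrow>
     Vector_Spaces.linear scale scale \<phi> \<and>
     (\<forall>x y. \<phi> (bracket x y) = scale (1/2) (bracket (\<phi> x) y + bracket x (\<phi> y)))"

text \<open>
  The complex vector space with basis indexed by \<open>'g\<close> is the type \<open>'g \<Rightarrow>\<^sub>0 complex\<close> of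
  finitely supported functions; the abelian group \<open>\<Gamma>\<close> is the type \<open>'g\<close> itself.
\<close>

definition witt_scale :: "complex \<Rightarrow> ('g \<Rightarrow>\<^sub>0 complex) \<Rightarrow> ('g \<Rightarrow>\<^sub>0 complex)" where
  "witt_scale c x = Poly_Mapping.map ((*) c) x"

definition witt_basis :: "'g \<Rightarrow> ('g \<Rightarrow>\<^sub>0 complex)" where
  "witt_basis \<alpha> = Poly_Mapping.single \<alpha> 1"

text \<open>The bilinear extension of \<open>[e\<^sub>\<alpha>, e\<^sub>\<beta>] = (f \<beta> - f \<alpha>) e\<^bsub>\<alpha>+\<beta>\<^esub>\<close>; see \<open>witt_bracket_basis\<close>
  and \<open>lie_algebra_witt\<close> below.\<close>

definition witt_bracket ::
    "('g::ab_group_add \<Rightarrow> complex) \<Rightarrow> ('g \<Rightarrow>\<^sub>0 complex) \<Rightarrow> ('g \<Rightarrow>\<^sub>0 complex) \<Rightarrow> ('g \<Rightarrow>\<^sub>0 complex)" where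
  "witt_bracket f x y =
     (\<Sum>\<alpha>\<in>Poly_Mapping.keys x. \<Sum>\<beta>\<in>Poly_Mapping.keys y.
        witt_scale (Poly_Mapping.lookup x \<alpha> * Poly_Mapping.lookup y \<beta> * (f \<beta> - f \<alpha>))
          (witt_basis (\<alpha> + \<beta>)))"

lemma lookup_witt_scale [simp]:
  "Poly_Mapping.lookup (witt_scale c x) \<alpha> = c * Poly_Mapping.lookup x \<alpha>"
  unfolding witt_scale_def by (simp add: Poly_Mapping.map.rep_eq when_def)

lemma vector_space_witt: "vector_space (witt_scale :: complex \<Rightarrow> ('g \<Rightarrow>\<^sub>0 complex) \<Rightarrow> _)"
  by unfold_locales (auto intro!: poly_mapping_eqI simp: lookup_add algebra_simps)

interpretation witt: vector_space "witt_scale :: complex \<Rightarrow> ('g \<Rightarrow>\<^sub>0 complex) \<Rightarrow> _"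
  by (rule vector_space_witt)

interpretation witt_pair: vector_space_pair
    "witt_scale :: complex \<Rightarrow> ('g \<Rightarrow>\<^sub>0 complex) \<Rightarrow> _" "witt_scale :: complex \<Rightarrow> ('g \<Rightarrow>\<^sub>0 complex) \<Rightarrow> _"
  by unfold_locales

lemma witt_bracket_basis:
  "witt_bracket f (witt_basis \<alpha>) (witt_basis \<beta>) = witt_scale (f \<beta> - f \<alpha>) (witt_basis (\<alpha> + \<beta>))"
  unfolding witt_bracket_def witt_basis_def by simp

lemma witt_bracket_superset:
  assumes "finite A" "finite B" "Poly_Mapping.keys x \<subseteq> A" "Poly_Mapping.keys y \<subseteq> B"
  shows "witt_bracket f x y =
     (\<Sum>\<alpha>\<in>A. \<Sum>\<beta>\<in>B.
        witt_scale (Poly_Mapping.lookup x \<alpha> * Poly_Mapping.lookup y \<beta> * (f \<beta> - f \<alpha>))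
          (witt_basis (\<alpha> + \<beta>)))"
proof -
  have "witt_bracket f x y = (\<Sum>\<alpha>\<in>Poly_Mapping.keys x. \<Sum>\<beta>\<in>B.
        witt_scale (Poly_Mapping.lookup x \<alpha> * Poly_Mapping.lookup y \<beta> * (f \<beta> - f \<alpha>))
          (witt_basis (\<alpha> + \<beta>)))"
    unfolding witt_bracket_def
    by (intro sum.cong refl sum.mono_neutral_left) (use assms in \<open>auto simp: in_keys_iff\<close>)
  also have "\<dots> = (\<Sum>\<alpha>\<in>A. \<Sum>\<beta>\<in>B.
        witt_scale (Poly_Mapping.lookup x \<alpha> * Poly_Mapping.lookup y \<beta> * (f \<beta> - f \<alpha>))
          (witt_basis (\<alpha> + \<beta>)))"
    by (intro sum.mono_neutral_left) (use assms in \<open>auto simp: in_keys_iff\<close>)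
  finally show ?thesis .
qed

lemma keys_witt_scale: "Poly_Mapping.keys (witt_scale c x) \<subseteq> Poly_Mapping.keys x"
  by (auto simp: in_keys_iff)

lemma witt_bracket_swap: "witt_bracket f y x = - witt_bracket f x y"
proof -
  have "witt_bracket f y x = (\<Sum>\<alpha>\<in>Poly_Mapping.keys x. \<Sum>\<beta>\<in>Poly_Mapping.keys y.
        witt_scale (Poly_Mapping.lookup y \<beta> * Poly_Mapping.lookup x \<alpha> * (f \<alpha> - f \<beta>))
          (witt_basis (\<beta> + \<alpha>)))"
    unfolding witt_bracket_def by (rule sum.swap)
  also have "\<dots> = - witt_bracket f x y"
    unfolding witt_bracket_def sum_negf[symmetric]
    by (intro sum.cong refl poly_mapping_eqI) (simp add: algebra_simps)
  finally show ?thesis .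
qed

lemma linear_witt_bracket_right: "Vector_Spaces.linear witt_scale witt_scale (witt_bracket f x)"
proof (intro Vector_Spaces.linear_iff[THEN iffD2] conjI allI vector_space_witt)
  fix y z :: "'a \<Rightarrow>\<^sub>0 complex" and c
  let ?B = "Poly_Mapping.keys y \<union> Poly_Mapping.keys z"
  have B: "finite ?B" "Poly_Mapping.keys (y + z) \<subseteq> ?B"
    using Poly_Mapping.keys_add[of y z] by auto
  show "witt_bracket f x (y + z) = witt_bracket f x y + witt_bracket f x z"
    using B
    by (simp add: witt_bracket_superset[of "Poly_Mapping.keys x" ?B] lookup_add sum.distrib[symmetric]
        distrib_left distrib_right witt.scale_left_distrib)
  show "witt_bracket f x (witt_scale c y) = witt_scale c (witt_bracket f x y)"
    using keys_witt_scale[of c y]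
    by (simp add: witt_bracket_superset[of "Poly_Mapping.keys x" "Poly_Mapping.keys y"]
        witt.scale_sum_right algebra_simps)
qed

lemma linear_witt_bracket_left:
  "Vector_Spaces.linear witt_scale witt_scale (\<lambda>x. witt_bracket f x y)"
proof -
  have "(\<lambda>x. witt_bracket f x y) = (\<lambda>x. - witt_bracket f y x)"
    by (rule ext) (rule witt_bracket_swap)
  then show ?thesis
    using witt_pair.linear_compose_neg[OF linear_witt_bracket_right[of f y]] by simp
qed

lemma witt_expansion:
  "x = (\<Sum>\<alpha>\<in>Poly_Mapping.keys x. witt_scale (Poly_Mapping.lookup x \<alpha>) (witt_basis \<alpha>))"
  by (rule poly_mapping_eqI)
     (simp add: Poly_Mapping.lookup_sum witt_basis_def lookup_single when_def in_keys_iff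
       if_distrib[of "(*) _"] sum.delta cong: if_cong)

lemma witt_linear_zero:
  assumes "Vector_Spaces.linear witt_scale witt_scale T" and "\<And>\<alpha>. T (witt_basis \<alpha>) = 0"
  shows "T x = (0 :: 'g \<Rightarrow>\<^sub>0 complex)"
proof -
  interpret T: Vector_Spaces.linear witt_scale witt_scale T by (rule assms(1))
  show ?thesis
    by (subst witt_expansion) (simp add: T.sum T.scale assms(2))
qed

lemma lie_algebra_witt:
  fixes f :: "'g::ab_group_add \<Rightarrow> complex"
  assumes f: "\<And>\<alpha> \<beta>. (f (\<alpha> + \<beta>) - f \<alpha> - f \<beta>) * (f \<alpha> - f \<beta>) = 0"
  shows "lie_algebra witt_scale (witt_bracket f)"
proof unfold_locales
  fix x y z :: "'g \<Rightarrow>\<^sub>0 complex"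
  let ?L = "Vector_Spaces.linear (witt_scale :: complex \<Rightarrow> ('g \<Rightarrow>\<^sub>0 complex) \<Rightarrow> _) witt_scale"
  show "witt_bracket f (x + y) z = witt_bracket f x z + witt_bracket f y z" for x y z
    using linear_witt_bracket_left[of f z] by (simp add: Vector_Spaces.linear_iff)
  show "witt_bracket f (witt_scale c x) z = witt_scale c (witt_bracket f x z)" for c x z
    using linear_witt_bracket_left[of f z] by (simp add: Vector_Spaces.linear_iff)
  show "witt_bracket f z (x + y) = witt_bracket f z x + witt_bracket f z y" for x y z
    using linear_witt_bracket_right[of f z] by (simp add: Vector_Spaces.linear_iff)
  show "witt_bracket f z (witt_scale c x) = witt_scale c (witt_bracket f z x)" for c x z
    using linear_witt_bracket_right[of f z] by (simp add: Vector_Spaces.linear_iff)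
  show "witt_bracket f x x = 0"
  proof (rule poly_mapping_eqI)
    fix \<alpha>
    have "Poly_Mapping.lookup (witt_bracket f x x) \<alpha> = - Poly_Mapping.lookup (witt_bracket f x x) \<alpha>"
      by (metis witt_bracket_swap lookup_uminus uminus_poly_mapping.rep_eq)
    then show "Poly_Mapping.lookup (witt_bracket f x x) \<alpha> = Poly_Mapping.lookup 0 \<alpha>"
      by (simp add: eq_neg_iff_add_eq_0)
  qed
  let ?J = "\<lambda>x y z. witt_bracket f x (witt_bracket f y z) + witt_bracket f y (witt_bracket f z x)
    + witt_bracket f z (witt_bracket f x y)"
  note comp = Vector_Spaces.linear_compose[unfolded o_def]
  have lin1: "?L (\<lambda>x. ?J x y z)" for y z
    by (intro witt_pair.linear_compose_add linear_witt_bracket_left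
        comp[OF _ linear_witt_bracket_right] linear_witt_bracket_right)
  have lin2: "?L (\<lambda>y. ?J x y z)" for x z
    using lin1[of z x] by (simp add: add_ac)
  have lin3: "?L (\<lambda>z. ?J x y z)" for x y
    using lin1[of x y] by (simp add: add_ac)
  have key: "(f \<gamma> - f \<beta>) * (f (\<beta> + \<gamma>) - f \<alpha>) = (f \<gamma> - f \<beta>) * (f \<beta> + f \<gamma> - f \<alpha>)" for \<alpha> \<beta> \<gamma>
    using f[of \<beta> \<gamma>] by (auto simp: diff_eq_eq add_ac)
  have "?J (witt_basis \<alpha>) (witt_basis \<beta>) (witt_basis \<gamma>) = 0" for \<alpha> \<beta> \<gamma>
  proof -
    have br: "witt_bracket f (witt_basis \<alpha>) (witt_scale c (witt_basis \<beta>)) =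
        witt_scale (c * (f \<beta> - f \<alpha>)) (witt_basis (\<alpha> + \<beta>))" for c \<alpha> \<beta>
      using linear_witt_bracket_right[of f "witt_basis \<alpha>"]
      by (simp add: Vector_Spaces.linear_iff witt_bracket_basis)
    have "?J (witt_basis \<alpha>) (witt_basis \<beta>) (witt_basis \<gamma>) =
      witt_scale ((f \<gamma> - f \<beta>) * (f (\<beta> + \<gamma>) - f \<alpha>) + (f \<alpha> - f \<gamma>) * (f (\<gamma> + \<alpha>) - f \<beta>)
        + (f \<beta> - f \<alpha>) * (f (\<alpha> + \<beta>) - f \<gamma>)) (witt_basis (\<alpha> + \<beta> + \<gamma>))"
      unfolding witt_bracket_basis br witt.scale_left_distrib by (simp only: add_ac)
    also have "\<dots> = 0"
      unfolding key by (simp add: algebra_simps)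
    finally show ?thesis .
  qed
  then have "?J (witt_basis \<alpha>) (witt_basis \<beta>) z = 0" for \<alpha> \<beta>
    by (rule witt_linear_zero[OF lin3])
  then have "?J (witt_basis \<alpha>) y z = 0" for \<alpha>
    by (rule witt_linear_zero[OF lin2])
  then show "?J x y z = 0"
    by (rule witt_linear_zero[OF lin1])
qed

end

theory Submission
  imports Defs
begin

text \<open>
  Write \<open>C \<alpha> \<gamma>\<close> for the coefficient of \<open>e\<^bsub>\<alpha>+\<gamma>\<^esub>\<close> in \<open>\<phi> e\<^sub>\<alpha>\<close>. Every bracket is homogeneous for the
  \<open>\<Gamma>\<close>-grading, so the condition on a \<open>1/2\<close>-derivation splits into one scalar equation for each
  triple of degrees (\<open>half_derivation_witt_iff\<close>):
  \<open>2 (f \<beta> - f \<alpha>) C (\<alpha>+\<beta>) \<gamma> = (f \<beta> - f (\<alpha>+\<gamma>)) C \<alpha> \<gamma> + (f (\<beta>+\<gamma>) - f \<alpha>) C \<beta> \<gamma>\<close>.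
  The different shifts \<open>\<gamma>\<close> do not interact.

  Together with \<open>f 0 = 0\<close>, the functional equation makes \<open>\<Gamma>\<^sub>0 = f\<inverse>(0)\<close> a subgroup on whose cosets \<open>f\<close> is constant
  (\<open>witt_function_add_kernel\<close>), and \<open>|f(\<Gamma>)| = 2\<close> leaves a single nonzero value \<open>c\<close>. The
  equations for one \<open>\<gamma>\<close> are then solved by \<open>a \<gamma> = C 0 \<gamma>\<close> (\<open>coefficient_equations_solution\<close>):
  bracketing with \<open>e\<^sub>0\<close> gives all of \<open>C \<beta> \<gamma>\<close> except when both \<open>\<beta>\<close> and \<open>\<gamma>\<close> lie in \<open>\<Gamma>\<^sub>0\<close>. The
  equation becomes vacuous there, and bracketing \<open>e\<^sub>\<beta>\<close> with a basis vector of degree outside \<open>\<Gamma>\<^sub>0\<close>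
  supplies the missing values. Conversely, for \<open>\<gamma> \<in> \<Gamma>\<^sub>0\<close> the shift leaves \<open>f\<close> unchanged and \<open>C\<close> is
  constant, so the right-hand side is twice the bracket coefficient times \<open>C\<close>; for \<open>\<gamma> \<notin> \<Gamma>\<^sub>0\<close> the unknown
  \<open>C\<close> vanishes outside \<open>\<Gamma>\<^sub>0\<close>, and shifting a degree in \<open>\<Gamma>\<^sub>0\<close> by \<open>\<gamma>\<close> raises \<open>f\<close> from \<open>0\<close> to \<open>c\<close>,
  which makes the remaining terms cancel.
\<close>

lemma lookup_witt_bracket_basis_right:
  "Poly_Mapping.lookup (witt_bracket f x (witt_basis \<beta>)) (\<beta> + \<delta>)
     = (f \<beta> - f \<delta>) * Poly_Mapping.lookup x \<delta>"
  unfolding witt_bracket_def witt_basis_def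
  by (simp add: lookup_sum lookup_single when_def add.commute[of _ \<beta>] if_distrib[of "(*) _"]
      sum.delta in_keys_iff cong: if_cong)

lemma lookup_witt_bracket_basis_left:
  "Poly_Mapping.lookup (witt_bracket f (witt_basis \<alpha>) y) (\<alpha> + \<delta>)
     = (f \<delta> - f \<alpha>) * Poly_Mapping.lookup y \<delta>"
  by (subst witt_bracket_swap) (simp add: lookup_witt_bracket_basis_right algebra_simps)

text \<open>
  The defect of the \<open>1/2\<close>-Leibniz rule is bilinear, hence vanishes as soon as it does on pairs of
  basis vectors; there it is read off coefficient by coefficient.
\<close>

lemma half_derivation_witt_iff:
  fixes f :: "'g::ab_group_add \<Rightarrow> complex"
  defines "C \<equiv> \<lambda>\<phi> \<alpha> \<gamma>. Poly_Mapping.lookup (\<phi> (witt_basis \<alpha>)) (\<alpha> + \<gamma>)"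
  shows "half_derivation witt_scale (witt_bracket f) \<phi> \<longleftrightarrow>
    Vector_Spaces.linear witt_scale witt_scale \<phi> \<and>
    (\<forall>\<gamma> \<alpha> \<beta>. 2 * (f \<beta> - f \<alpha>) * C \<phi> (\<alpha> + \<beta>) \<gamma>
        = (f \<beta> - f (\<alpha> + \<gamma>)) * C \<phi> \<alpha> \<gamma> + (f (\<beta> + \<gamma>) - f \<alpha>) * C \<phi> \<beta> \<gamma>)"
    (is "_ \<longleftrightarrow> ?L \<phi> \<and> (\<forall>\<gamma> \<alpha> \<beta>. ?E \<alpha> \<beta> \<gamma>)")
proof (cases "?L \<phi>")
  case False
  then show ?thesis by (simp add: half_derivation_def)
next
  case lin: True
  define D where "D x y = \<phi> (witt_bracket f x y)
    - witt_scale (1/2) (witt_bracket f (\<phi> x) y + witt_bracket f x (\<phi> y))" for x y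
  note comp = Vector_Spaces.linear_compose[unfolded o_def]
  have lin1: "?L (\<lambda>x. D x y)" for y
    unfolding D_def
    by (intro witt_pair.linear_compose_sub witt_pair.linear_compose_scale_right
        witt_pair.linear_compose_add comp[OF _ lin] comp[OF lin] linear_witt_bracket_left)
  have lin2: "?L (D x)" for x
    unfolding D_def
    by (intro witt_pair.linear_compose_sub witt_pair.linear_compose_scale_right
        witt_pair.linear_compose_add comp[OF _ lin] comp[OF lin] linear_witt_bracket_right)
  have coeff: "Poly_Mapping.lookup (D (witt_basis \<alpha>) (witt_basis \<beta>)) (\<alpha> + \<beta> + \<gamma>) = 0
      \<longleftrightarrow> ?E \<alpha> \<beta> \<gamma>" for \<alpha> \<beta> \<gamma>
  proof -
    have br: "\<phi> (witt_bracket f (witt_basis \<alpha>) (witt_basis \<beta>))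
        = witt_scale (f \<beta> - f \<alpha>) (\<phi> (witt_basis (\<alpha> + \<beta>)))"
      using lin by (simp add: witt_bracket_basis Vector_Spaces.linear_iff)
    have left: "Poly_Mapping.lookup (witt_bracket f (\<phi> (witt_basis \<alpha>)) (witt_basis \<beta>))
        (\<alpha> + \<beta> + \<gamma>) = (f \<beta> - f (\<alpha> + \<gamma>)) * C \<phi> \<alpha> \<gamma>"
      using lookup_witt_bracket_basis_right[of f "\<phi> (witt_basis \<alpha>)" \<beta> "\<alpha> + \<gamma>"]
      by (simp add: C_def add_ac)
    have right: "Poly_Mapping.lookup (witt_bracket f (witt_basis \<alpha>) (\<phi> (witt_basis \<beta>)))
        (\<alpha> + \<beta> + \<gamma>) = (f (\<beta> + \<gamma>) - f \<alpha>) * C \<phi> \<beta> \<gamma>"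
      using lookup_witt_bracket_basis_left[of f \<alpha> "\<phi> (witt_basis \<beta>)" "\<beta> + \<gamma>"]
      by (simp add: C_def add_ac)
    have "2 * Poly_Mapping.lookup (D (witt_basis \<alpha>) (witt_basis \<beta>)) (\<alpha> + \<beta> + \<gamma>)
        = 2 * (f \<beta> - f \<alpha>) * C \<phi> (\<alpha> + \<beta>) \<gamma>
          - ((f \<beta> - f (\<alpha> + \<gamma>)) * C \<phi> \<alpha> \<gamma> + (f (\<beta> + \<gamma>) - f \<alpha>) * C \<phi> \<beta> \<gamma>)"
      unfolding D_def lookup_minus lookup_witt_scale lookup_add br left right
      by (simp add: C_def field_simps)
    then show ?thesis
      by (metis eq_iff_diff_eq_0 mult_eq_0_iff zero_neq_numeral)
  qed
  have "half_derivation witt_scale (witt_bracket f) \<phi> \<longleftrightarrow> (\<forall>x y. D x y = 0)"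
    using lin by (simp add: half_derivation_def D_def)
  also have "\<dots> \<longleftrightarrow> (\<forall>\<alpha> \<beta>. D (witt_basis \<alpha>) (witt_basis \<beta>) = 0)"
    using witt_linear_zero[OF lin1] witt_linear_zero[OF lin2] by blast
  also have "\<dots> \<longleftrightarrow> (\<forall>\<gamma> \<alpha> \<beta>. ?E \<alpha> \<beta> \<gamma>)"
  proof (intro iffI allI)
    show "?E \<alpha> \<beta> \<gamma>" if "\<forall>\<alpha> \<beta>. D (witt_basis \<alpha>) (witt_basis \<beta>) = 0" for \<alpha> \<beta> \<gamma>
      using that coeff[of \<alpha> \<beta> \<gamma>] by simp
    show "D (witt_basis \<alpha>) (witt_basis \<beta>) = 0" if "\<forall>\<gamma> \<alpha> \<beta>. ?E \<alpha> \<beta> \<gamma>" for \<alpha> \<beta>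
    proof (rule poly_mapping_eqI)
      fix \<delta>
      show "Poly_Mapping.lookup (D (witt_basis \<alpha>) (witt_basis \<beta>)) \<delta> = Poly_Mapping.lookup 0 \<delta>"
        using that coeff[of \<alpha> \<beta> "\<delta> - (\<alpha> + \<beta>)"] by simp
    qed
  qed
  finally show ?thesis using lin by simp
qed

text \<open>
  When \<open>f \<beta> \<noteq> 0\<close> this is the functional equation itself. When \<open>f \<beta> = 0\<close> the equation is vacuous at
  \<open>(\<alpha>, \<beta>)\<close>, and the claim is that \<open>f\<inverse>(0)\<close> is closed under addition: a nonzero value at
  \<open>\<alpha> + \<beta>\<close> would be transported to \<open>\<beta>\<close> by adding \<open>-\<alpha>\<close>.
\<close>

lemma witt_function_add_kernel:
  fixes f :: "'g::ab_group_add \<Rightarrow> complex"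
  assumes f0: "f 0 = 0"
    and f: "\<And>\<alpha> \<beta>. (f (\<alpha> + \<beta>) - f \<alpha> - f \<beta>) * (f \<alpha> - f \<beta>) = 0"
    and \<alpha>: "f \<alpha> = 0"
  shows "f (\<alpha> + \<beta>) = f \<beta>"
proof -
  have "f (- \<alpha>) = 0"
    using f[of \<alpha> "- \<alpha>"] f0 \<alpha> by simp
  then show ?thesis
    using f[of \<alpha> \<beta>] f[of "- \<alpha>" "\<alpha> + \<beta>"] \<alpha> by auto
qed

text \<open>
  For fixed \<open>\<gamma>\<close> the solution space of the coefficient equations is one-dimensional, parametrised
  by the value at degree \<open>0\<close>. The argument \<open>\<gamma>\<close> of the unknown is suppressed.
\<close>

lemma coefficient_equations_solution:
  fixes f :: "'g::ab_group_add \<Rightarrow> complex" and C :: "'g \<Rightarrow> complex"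
  assumes add: "\<And>\<alpha> \<beta>. f \<alpha> = 0 \<Longrightarrow> f (\<alpha> + \<beta>) = f \<beta>"
    and two: "range f = {0, c}" and c: "c \<noteq> 0" and f0: "f 0 = 0"
  shows "(\<forall>\<alpha> \<beta>. 2 * (f \<beta> - f \<alpha>) * C (\<alpha> + \<beta>)
        = (f \<beta> - f (\<alpha> + \<gamma>)) * C \<alpha> + (f (\<beta> + \<gamma>) - f \<alpha>) * C \<beta>)
     \<longleftrightarrow> (\<forall>\<alpha>. C \<alpha> = (if f \<alpha> = 0 \<or> f \<gamma> = 0 then C 0 else 0))"
    (is "?eqs \<longleftrightarrow> ?sol")
proof
  have vals: "f \<alpha> = 0 \<or> f \<alpha> = c" for \<alpha>
    using two by blast
  have add': "f (\<alpha> + \<beta>) = f \<alpha>" if "f \<beta> = 0" for \<alpha> \<beta>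
    using add[OF that, of \<alpha>] by (simp add: add.commute)
  show ?sol if ?eqs
  proof
    fix \<beta>
    from \<open>?eqs\<close> have E: "2 * (f \<beta> - f \<alpha>) * C (\<alpha> + \<beta>)
        = (f \<beta> - f (\<alpha> + \<gamma>)) * C \<alpha> + (f (\<beta> + \<gamma>) - f \<alpha>) * C \<beta>" for \<alpha> \<beta>
      by blast
    have off_kernel: "C \<beta> = (if f \<gamma> = 0 then C 0 else 0)" if \<beta>: "f \<beta> \<noteq> 0" for \<beta>
    proof -
      have f\<beta>: "f \<beta> = c" using vals \<beta> by blast
      show ?thesis
      proof (cases "f \<gamma> = 0")
        case True
        then show ?thesis
          using E[of \<beta> 0] c by (simp add: f\<beta> f0 add')
      next
        case False
        then have "f \<gamma> = c" using vals by blast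
        \<comment> \<open>here \<open>f (\<beta> + \<gamma>)\<close> may be \<open>0\<close> or \<open>c\<close>; either way it cannot match the factor \<open>2 c\<close>\<close>
        then show ?thesis
          using E[of \<beta> 0] vals[of "\<beta> + \<gamma>"] c by (auto simp: f\<beta> f0)
      qed
    qed
    obtain \<epsilon> where \<epsilon>: "f \<epsilon> = c" using two by (metis insertI1 insertI2 rangeE)
    show "C \<beta> = (if f \<beta> = 0 \<or> f \<gamma> = 0 then C 0 else 0)"
    proof (cases "f \<beta> = 0")
      case False
      then show ?thesis using off_kernel by simp
    next
      case \<beta>: True
      show ?thesis
      proof (cases "f \<gamma> = 0")
        case True
        \<comment> \<open>\<open>\<beta> + \<epsilon>\<close> and \<open>\<epsilon>\<close> both lie outside the kernel, where \<open>C\<close> is known already\<close>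
        have "C (\<beta> + \<epsilon>) = C 0" "C \<epsilon> = C 0"
          using True off_kernel \<epsilon> c by (simp_all add: add[OF \<beta>])
        then show ?thesis
          using E[of \<epsilon> \<beta>] c True \<beta> \<epsilon> by (simp add: add')
      next
        case False
        then show ?thesis
          using E[of \<beta> 0] \<beta> by (simp add: add f0)
      qed
    qed
  qed
  show ?eqs if sol: ?sol
  proof (intro allI)
    fix \<alpha> \<beta>
    have C: "C \<delta> = (if f \<delta> = 0 \<or> f \<gamma> = 0 then C 0 else 0)" for \<delta>
      using sol by blast
    consider "f \<gamma> = 0" | "f \<gamma> = c" using vals by blast
    then show "2 * (f \<beta> - f \<alpha>) * C (\<alpha> + \<beta>)
        = (f \<beta> - f (\<alpha> + \<gamma>)) * C \<alpha> + (f (\<beta> + \<gamma>) - f \<alpha>) * C \<beta>"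
    proof cases
      case 1
      then have "C \<delta> = C 0" for \<delta> using C by simp
      then show ?thesis
        using 1 by (metis (no_types) add' distrib_right mult_2)
    next
      case 2
      then show ?thesis
        using vals[of \<alpha>] vals[of \<beta>] c
        by (auto simp: C[of \<alpha>] C[of \<beta>] C[of "\<alpha> + \<beta>"] add add')
    qed
  qed
qed

lemma witt_sum_eq_iff:
  fixes a :: "'g::ab_group_add \<Rightarrow> complex"
  assumes "finite {\<gamma>. a \<gamma> \<noteq> 0}"
  shows "x = (\<Sum>\<gamma> | P \<gamma> \<and> a \<gamma> \<noteq> 0. witt_scale (a \<gamma>) (witt_basis (\<alpha> + \<gamma>)))
    \<longleftrightarrow> (\<forall>\<gamma>. Poly_Mapping.lookup x (\<alpha> + \<gamma>) = (if P \<gamma> then a \<gamma> else 0))"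
    (is "x = ?s \<longleftrightarrow> _")
proof -
  have fin: "finite {\<gamma>. P \<gamma> \<and> a \<gamma> \<noteq> 0}"
    by (rule finite_subset[OF _ assms]) auto
  have "Poly_Mapping.lookup ?s (\<alpha> + \<delta>) = (if P \<delta> then a \<delta> else 0)" for \<delta>
  proof -
    have "Poly_Mapping.lookup ?s (\<alpha> + \<delta>) = (\<Sum>\<gamma> | P \<gamma> \<and> a \<gamma> \<noteq> 0. if \<gamma> = \<delta> then a \<gamma> else 0)"
      by (auto simp: lookup_sum witt_basis_def lookup_single when_def intro!: sum.cong)
    also have "\<dots> = (if P \<delta> then a \<delta> else 0)"
      using fin by (simp add: sum.delta)
    finally show ?thesis .
  qed
  moreover have "x = ?s \<longleftrightarrow>
      (\<forall>\<gamma>. Poly_Mapping.lookup x (\<alpha> + \<gamma>) = Poly_Mapping.lookup ?s (\<alpha> + \<gamma>))"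
  proof (intro iffI poly_mapping_eqI)
    fix \<delta>
    assume "\<forall>\<gamma>. Poly_Mapping.lookup x (\<alpha> + \<gamma>) = Poly_Mapping.lookup ?s (\<alpha> + \<gamma>)"
    from this[rule_format, of "\<delta> - \<alpha>"]
    show "Poly_Mapping.lookup x \<delta> = Poly_Mapping.lookup ?s \<delta>"
      by simp
  qed simp
  ultimately show ?thesis by simp
qed

theorem proposition21:
  fixes f :: "'g::ab_group_add \<Rightarrow> complex"
    and \<phi> :: "('g \<Rightarrow>\<^sub>0 complex) \<Rightarrow> ('g \<Rightarrow>\<^sub>0 complex)"
  assumes "f 0 = 0"
    and "\<And>\<alpha> \<beta>. (f (\<alpha> + \<beta>) - f \<alpha> - f \<beta>) * (f \<alpha> - f \<beta>) = 0"
    and "card (range f) = 2"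
  shows "half_derivation witt_scale (witt_bracket f) \<phi> \<longleftrightarrow>
    Vector_Spaces.linear witt_scale witt_scale \<phi> \<and>
    (\<exists>a :: 'g \<Rightarrow> complex. finite {\<gamma>. a \<gamma> \<noteq> 0} \<and>
      (\<forall>\<alpha>. \<phi> (witt_basis \<alpha>) =
        (if \<alpha> \<in> f -` {0}
         then \<Sum>\<gamma> | a \<gamma> \<noteq> 0. witt_scale (a \<gamma>) (witt_basis (\<alpha> + \<gamma>))
         else \<Sum>\<gamma> | \<gamma> \<in> f -` {0} \<and> a \<gamma> \<noteq> 0. witt_scale (a \<gamma>) (witt_basis (\<alpha> + \<gamma>)))))"
proof -
  obtain c where two: "range f = {0, c}" and c: "c \<noteq> 0"
  proof -
    obtain u v where uv: "range f = {u, v}" "u \<noteq> v"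
      using assms(3) by (auto simp: card_2_iff)
    moreover have "0 \<in> range f" using assms(1) by (metis rangeI)
    ultimately show ?thesis using that by (metis insert_commute insert_iff singletonD)
  qed
  have add: "f (\<alpha> + \<beta>) = f \<beta>" if "f \<alpha> = 0" for \<alpha> \<beta>
    by (rule witt_function_add_kernel[OF assms(1,2) that])
  define C where "C \<alpha> \<gamma> = Poly_Mapping.lookup (\<phi> (witt_basis \<alpha>)) (\<alpha> + \<gamma>)" for \<alpha> \<gamma>
  have fin: "finite {\<gamma>. C 0 \<gamma> \<noteq> 0}"
    by (simp add: C_def)
  have sol: "(\<forall>\<alpha> \<beta>. 2 * (f \<beta> - f \<alpha>) * C (\<alpha> + \<beta>) \<gamma>
        = (f \<beta> - f (\<alpha> + \<gamma>)) * C \<alpha> \<gamma> + (f (\<beta> + \<gamma>) - f \<alpha>) * C \<beta> \<gamma>)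
     \<longleftrightarrow> (\<forall>\<alpha>. C \<alpha> \<gamma> = (if f \<alpha> = 0 \<or> f \<gamma> = 0 then C 0 \<gamma> else 0))" for \<gamma>
    by (rule coefficient_equations_solution[OF add two c assms(1)])
  have "half_derivation witt_scale (witt_bracket f) \<phi> \<longleftrightarrow>
      Vector_Spaces.linear witt_scale witt_scale \<phi> \<and>
      (\<forall>\<gamma> \<alpha>. C \<alpha> \<gamma> = (if f \<alpha> = 0 \<or> f \<gamma> = 0 then C 0 \<gamma> else 0))"
    by (simp only: half_derivation_witt_iff C_def[symmetric] sol)
  also have "(\<forall>\<gamma> \<alpha>. C \<alpha> \<gamma> = (if f \<alpha> = 0 \<or> f \<gamma> = 0 then C 0 \<gamma> else 0)) \<longleftrightarrow>
      (\<exists>a. finite {\<gamma>. a \<gamma> \<noteq> 0} \<and> (\<forall>\<gamma> \<alpha>. C \<alpha> \<gamma> = (if f \<alpha> = 0 \<or> f \<gamma> = 0 then a \<gamma> else 0)))"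
    (is "?l \<longleftrightarrow> (\<exists>a. ?r a)")
  proof
    assume ?l
    with fin show "\<exists>a. ?r a" by blast
  next
    assume "\<exists>a. ?r a"
    then obtain a where a: "C \<alpha> \<gamma> = (if f \<alpha> = 0 \<or> f \<gamma> = 0 then a \<gamma> else 0)" for \<alpha> \<gamma>
      by blast
    have "C 0 \<gamma> = a \<gamma>" for \<gamma>
      using a[of 0 \<gamma>] assms(1) by simp
    with a show ?l by simp
  qed
  also have "\<dots> \<longleftrightarrow> (\<exists>a :: 'g \<Rightarrow> complex. finite {\<gamma>. a \<gamma> \<noteq> 0} \<and>
      (\<forall>\<alpha>. \<phi> (witt_basis \<alpha>) =
        (if \<alpha> \<in> f -` {0}
         then \<Sum>\<gamma> | a \<gamma> \<noteq> 0. witt_scale (a \<gamma>) (witt_basis (\<alpha> + \<gamma>))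
         else \<Sum>\<gamma> | \<gamma> \<in> f -` {0} \<and> a \<gamma> \<noteq> 0. witt_scale (a \<gamma>) (witt_basis (\<alpha> + \<gamma>)))))"
  proof (intro ex_cong1 conj_cong refl)
    fix a :: "'g \<Rightarrow> complex"
    assume a: "finite {\<gamma>. a \<gamma> \<noteq> 0}"
    have "(\<forall>\<gamma>. C \<alpha> \<gamma> = (if f \<alpha> = 0 \<or> f \<gamma> = 0 then a \<gamma> else 0)) \<longleftrightarrow>
      \<phi> (witt_basis \<alpha>) =
        (if \<alpha> \<in> f -` {0}
         then \<Sum>\<gamma> | a \<gamma> \<noteq> 0. witt_scale (a \<gamma>) (witt_basis (\<alpha> + \<gamma>))
         else \<Sum>\<gamma> | \<gamma> \<in> f -` {0} \<and> a \<gamma> \<noteq> 0. witt_scale (a \<gamma>) (witt_basis (\<alpha> + \<gamma>)))" for \<alpha>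
      using witt_sum_eq_iff[OF a, where P = "\<lambda>_. True" and x = "\<phi> (witt_basis \<alpha>)" and \<alpha> = \<alpha>]
        witt_sum_eq_iff[OF a, where P = "\<lambda>\<gamma>. \<gamma> \<in> f -` {0}" and x = "\<phi> (witt_basis \<alpha>)" and \<alpha> = \<alpha>]
      by (simp add: C_def)
    then show "(\<forall>\<gamma> \<alpha>. C \<alpha> \<gamma> = (if f \<alpha> = 0 \<or> f \<gamma> = 0 then a \<gamma> else 0)) \<longleftrightarrow>
      (\<forall>\<alpha>. \<phi> (witt_basis \<alpha>) =
        (if \<alpha> \<in> f -` {0}
         then \<Sum>\<gamma> | a \<gamma> \<noteq> 0. witt_scale (a \<gamma>) (witt_basis (\<alpha> + \<gamma>))
         else \<Sum>\<gamma> | \<gamma> \<in> f -` {0} \<and> a \<gamma> \<noteq> 0. witt_scale (a \<gamma>) (witt_basis (\<alpha> + \<gamma>))))"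
      by blast
  qed
  finally show ?thesis .
qed

end
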